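(* Consider the distributed experts problem in the site prediction model with $k$ sites, time horizon $T$, and an oblivious adversary. At any time step $t$, suppose each site has an (approximate) cumulative payoff count $\tilde{\mathbf P}^t[a]$ for every expert $a$ such that $|\mathbf P^t[a]-\tilde{\mathbf P}^t[a]|\le\beta$. Then we have the following: 1. If $\beta\le k$, any algorithm that uses the approximate counts $\tilde{\mathbf P}^t[a]$ and any local information at the site making the decision cannot achieve expected regret asymptotically better than $\sqrt{\beta T}$. 2. Any protocol on the distributed system that guarantees that at each time step, each site has a $\beta=k/10$ approximate cumulative payoff with probability $\ge 1/2$, uses $\Omega(T)$ communication.
   Context: Site prediction model. A distributed system consists of one coordinator node connected to $k$ site nodes; sites communicate with each other only via the coordinator. There are $n$ experts (the lower bounds are shown for $n=2$) and a time horizon $T$. At each time step $t=1,\dots,T$ one site $s^t$ receives a query and must pick an expert $a^t\in[n]=\{1,\dots,n\}$; then the payoff vector $\mathbf p^t\in[0,1]^n$ is revealed only to the site $s^t$, and the system receives payoff $\mathbf p^t[a^t]$. An oblivious adversary chooses the sequences $(\mathbf p^t)$ and $(s^t)$; it may know the description of the algorithm but cannot see its actions, communication or random bits. $\mathbf P^t[a]$ denotes the true cumulative payoff of expert $a$ at time step $t$, i.e. the total of the payoffs $\mathbf p^\tau[a]$ so far. A $\beta$ approximate cumulative payoff is a value within additive error $\beta$ of it. The approximation guarantee is only required when a site receives a query and has to make a prediction. The class of algorithms considered (distributed counter algorithms) is: (i) whenever a site receives a query, it has an (approximate) cumulative payoff of each expert to additive accuracy $\beta$, and any communication is only used to maintain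 such a counter; (ii) any site only uses the (approximate) cumulative payoffs and any local information it may have to choose an expert when queried. Expected regret is $\mathbb E\big[\max_{a\in[n]}\sum_{t=1}^T\mathbf p^t[a]-\sum_{t=1}^T\mathbf p^t[a^t]\big]$. Communication is the (expected) number of messages sent in the system. *)

theory Defs
  imports "HOL-Probability.Probability"
begin

section \<open>Oblivious adversaries\<close>

text \<open>
  Time steps are \<open>0, \<dots>, T - 1\<close>, sites \<open>0, \<dots>, k - 1\<close> and experts \<open>0, \<dots>, n - 1\<close>.
  The adversary is oblivious: it fixes \<open>p\<close> and \<open>s\<close> as plain sequences, independent of the
  algorithm's randomness.  Payoff vectors are extensional, so that they carry no information
  beyond the payoffs of the \<open>n\<close> experts.
\<close>

type_synonym payoffs = "nat \<Rightarrow> nat \<Rightarrow> real"  \<comment> \<open>time, expert\<close>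
type_synonym queries = "nat \<Rightarrow> nat"  \<comment> \<open>time to queried site\<close>

definition adversary :: "nat \<Rightarrow> nat \<Rightarrow> nat \<Rightarrow> payoffs \<Rightarrow> queries \<Rightarrow> bool" where
  "adversary k n T p s \<longleftrightarrow> (\<forall>t<T. s t < k \<and> p t \<in> {..<n} \<rightarrow>\<^sub>E {0..1})"

text \<open>
  The prediction at step \<open>t\<close> is made before \<open>p t\<close> is revealed, hence the strict bound.
\<close>

definition cumulative :: "payoffs \<Rightarrow> nat \<Rightarrow> nat \<Rightarrow> real" where
  "cumulative p t a = (\<Sum>\<tau><t. p \<tau> a)"

section \<open>Deciding from approximate counts and local information\<close>

text \<open>
  \<open>C p s i t a\<close> is the count of expert \<open>a\<close> that site \<open>i\<close> has at step \<open>t\<close>.  A counter cannot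
  look ahead: at step \<open>t\<close> it may depend on the past and on which site is being queried.
\<close>

type_synonym counter = "payoffs \<Rightarrow> queries \<Rightarrow> nat \<Rightarrow> nat \<Rightarrow> nat \<Rightarrow> real"

definition causal :: "counter \<Rightarrow> bool" where
  "causal C \<longleftrightarrow>
    (\<forall>p p' s s' i t. (\<forall>\<tau><t. p \<tau> = p' \<tau>) \<longrightarrow> (\<forall>\<tau>\<le>t. s \<tau> = s' \<tau>) \<longrightarrow> C p s i t = C p' s' i t)"

definition approximate_counter :: "nat \<Rightarrow> nat \<Rightarrow> nat \<Rightarrow> real \<Rightarrow> counter \<Rightarrow> bool" where
  "approximate_counter k n T \<beta> C \<longleftrightarrow> causal C \<and>
    (\<forall>p s. adversary k n T p s \<longrightarrow>
      (\<forall>t<T. \<forall>i<k. C p s i t \<in> extensional {..<n} \<and>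
        (\<forall>a<n. \<bar>cumulative p t a - C p s i t a\<bar> \<le> \<beta>)))"

text \<open>
  What site \<open>i\<close> knows when it decides at step \<open>t\<close>: the payoff vectors revealed to it so far,
  with their time stamps, and all counts it has had up to and including step \<open>t\<close>.
\<close>

type_synonym information = "(nat \<times> (nat \<Rightarrow> real)) list \<times> (nat \<Rightarrow> real) list"

definition site_information :: "counter \<Rightarrow> payoffs \<Rightarrow> queries \<Rightarrow> nat \<Rightarrow> nat \<Rightarrow> information" where
  "site_information C p s i t =
    (map (\<lambda>\<tau>. (\<tau>, p \<tau>)) (filter (\<lambda>\<tau>. s \<tau> = i) [0..<t]), map (C p s i) [0..<Suc t])"

text \<open>
  \<open>A \<omega> i t h\<close> is the expert picked by site \<open>i\<close> at step \<open>t\<close> on information \<open>h\<close>, where \<open>\<omega>\<close> is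
  the random source.  All sites may read all of \<open>\<omega>\<close>; independent private randomness is the
  special case where \<open>\<omega>\<close> is a tuple and each site uses its own component.
\<close>

type_synonym 'w decision_rule = "'w \<Rightarrow> nat \<Rightarrow> nat \<Rightarrow> information \<Rightarrow> nat"

definition decision_algorithm :: "'w measure \<Rightarrow> nat \<Rightarrow> 'w decision_rule \<Rightarrow> bool" where
  "decision_algorithm M n A \<longleftrightarrow>
    prob_space M \<and> (\<forall>i t h. (\<lambda>\<omega>. A \<omega> i t h) \<in> M \<rightarrow>\<^sub>M count_space {..<n})"

definition chosen :: "'w decision_rule \<Rightarrow> counter \<Rightarrow> payoffs \<Rightarrow> queries \<Rightarrow> 'w \<Rightarrow> nat \<Rightarrow> nat" where
  "chosen A C p s \<omega> t = A \<omega> (s t) t (site_information C p s (s t) t)"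

definition expected_regret ::
  "'w measure \<Rightarrow> 'w decision_rule \<Rightarrow> counter \<Rightarrow> nat \<Rightarrow> nat \<Rightarrow> payoffs \<Rightarrow> queries \<Rightarrow> real" where
  "expected_regret M A C n T p s =
    (LINT \<omega>|M. (MAX a\<in>{..<n}. \<Sum>t<T. p t a) - (\<Sum>t<T. p t (chosen A C p s \<omega> t)))"

section \<open>Communication protocols\<close>

text \<open>
  Within step \<open>t\<close>, the queried site receives its query, messages are exchanged in synchronous
  rounds, the count is read off for the prediction, the payoff vector is revealed to the queried
  site, and messages are again exchanged in rounds.  A clock value \<open>(t, b, r)\<close> denotes round \<open>r\<close>
  of step \<open>t\<close>, before (\<open>b = False\<close>) or after (\<open>b = True\<close>) the payoff vector is revealed.
\<close>

type_synonym clock = "nat \<times> bool \<times> nat"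

datatype node = Coordinator | Site nat

datatype 'm event = Query | Reveal "nat \<Rightarrow> real" | Receive node 'm

type_synonym 'm view = "(clock \<times> 'm event) list"

text \<open>
  A node acts on its own view, the clock and the random source only.  \<open>send P \<omega> u c v w\<close> is what
  node \<open>u\<close> with view \<open>v\<close> sends to node \<open>w\<close> at clock \<open>c\<close>, if anything; \<open>estimate P \<omega> i t v a\<close> is
  the count of expert \<open>a\<close> that site \<open>i\<close> with view \<open>v\<close> has at its prediction in step \<open>t\<close>.  The
  number of rounds is arbitrary but does not depend on the input: otherwise the common clock would
  be a means of communication that is not counted.
\<close>

record ('w, 'm) protocol =
  rounds :: "'w \<Rightarrow> nat \<Rightarrow> nat"
  send :: "'w \<Rightarrow> node \<Rightarrow> clock \<Rightarrow> 'm view \<Rightarrow> node \<Rightarrow> 'm option"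
  estimate :: "'w \<Rightarrow> nat \<Rightarrow> nat \<Rightarrow> 'm view \<Rightarrow> nat \<Rightarrow> real"

definition neighbours :: "nat \<Rightarrow> node \<Rightarrow> node list" where
  "neighbours k u =
    (case u of Coordinator \<Rightarrow> map Site [0..<k] | Site i \<Rightarrow> if i < k then [Coordinator] else [])"

definition inbox ::
  "nat \<Rightarrow> ('w, 'm) protocol \<Rightarrow> 'w \<Rightarrow> clock \<Rightarrow> (node \<Rightarrow> 'm view) \<Rightarrow> node \<Rightarrow> 'm view" where
  "inbox k P \<omega> c V w =
    concat (map (\<lambda>u. case send P \<omega> u c (V u) w of None \<Rightarrow> [] | Some m \<Rightarrow> [(c, Receive u m)])
      (neighbours k w))"

primrec exchange ::
  "nat \<Rightarrow> ('w, 'm) protocol \<Rightarrow> 'w \<Rightarrow> nat \<Rightarrow> bool \<Rightarrow> nat \<Rightarrow> (node \<Rightarrow> 'm view) \<Rightarrow> node \<Rightarrow> 'm view"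
where
  "exchange k P \<omega> t b 0 V = V"
| "exchange k P \<omega> t b (Suc r) V =
    (let W = exchange k P \<omega> t b r V in (\<lambda>w. W w @ inbox k P \<omega> (t, b, r) W w))"

definition observe :: "node \<Rightarrow> clock \<Rightarrow> 'm event \<Rightarrow> (node \<Rightarrow> 'm view) \<Rightarrow> node \<Rightarrow> 'm view" where
  "observe u c e V = V(u := V u @ [(c, e)])"

definition before_prediction ::
  "nat \<Rightarrow> ('w, 'm) protocol \<Rightarrow> 'w \<Rightarrow> queries \<Rightarrow> nat \<Rightarrow> (node \<Rightarrow> 'm view) \<Rightarrow> node \<Rightarrow> 'm view" where
  "before_prediction k P \<omega> s t V =
    exchange k P \<omega> t False (rounds P \<omega> t) (observe (Site (s t)) (t, False, 0) Query V)"

definition after_prediction ::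
  "nat \<Rightarrow> ('w, 'm) protocol \<Rightarrow> 'w \<Rightarrow> payoffs \<Rightarrow> queries \<Rightarrow> nat \<Rightarrow> (node \<Rightarrow> 'm view) \<Rightarrow> node \<Rightarrow> 'm view"
where
  "after_prediction k P \<omega> p s t V =
    exchange k P \<omega> t True (rounds P \<omega> t) (observe (Site (s t)) (t, True, 0) (Reveal (p t)) V)"

text \<open>The views of all nodes after the first \<open>t\<close> steps.\<close>

primrec views ::
  "nat \<Rightarrow> ('w, 'm) protocol \<Rightarrow> 'w \<Rightarrow> payoffs \<Rightarrow> queries \<Rightarrow> nat \<Rightarrow> node \<Rightarrow> 'm view" where
  "views k P \<omega> p s 0 = (\<lambda>_. [])"
| "views k P \<omega> p s (Suc t) =
    after_prediction k P \<omega> p s t (before_prediction k P \<omega> s t (views k P \<omega> p s t))"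

definition count_at_prediction ::
  "nat \<Rightarrow> ('w, 'm) protocol \<Rightarrow> 'w \<Rightarrow> payoffs \<Rightarrow> queries \<Rightarrow> nat \<Rightarrow> nat \<Rightarrow> real" where
  "count_at_prediction k P \<omega> p s t =
    estimate P \<omega> (s t) t
      (before_prediction k P \<omega> s t (views k P \<omega> p s t) (Site (s t)))"

text \<open>
  Messages are never lost, so the messages sent are exactly those received.
\<close>

definition messages :: "nat \<Rightarrow> ('w, 'm) protocol \<Rightarrow> nat \<Rightarrow> payoffs \<Rightarrow> queries \<Rightarrow> 'w \<Rightarrow> nat" where
  "messages k P T p s \<omega> =
    (\<Sum>u \<in> insert Coordinator (Site ` {..<k}).
      length (filter (\<lambda>(c, e). \<exists>w m. e = Receive w m) (views k P \<omega> p s T u)))"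

definition randomized_protocol ::
  "'w measure \<Rightarrow> nat \<Rightarrow> nat \<Rightarrow> nat \<Rightarrow> ('w, 'm) protocol \<Rightarrow> bool" where
  "randomized_protocol M k n T P \<longleftrightarrow> prob_space M \<and>
    (\<forall>p s. adversary k n T p s \<longrightarrow>
      messages k P T p s \<in> M \<rightarrow>\<^sub>M count_space UNIV \<and>
      (\<forall>t<T. \<forall>a<n. (\<lambda>\<omega>. count_at_prediction k P \<omega> p s t a) \<in> borel_measurable M))"

text \<open>
  Accuracy is required of the queried site, at the time of its prediction.
\<close>

definition approximates_with_probability ::
  "'w measure \<Rightarrow> nat \<Rightarrow> nat \<Rightarrow> nat \<Rightarrow> real \<Rightarrow> real \<Rightarrow> ('w, 'm) protocol \<Rightarrow> bool" where
  "approximates_with_probability M k n T \<beta> q P \<longleftrightarrow>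
    (\<forall>p s. adversary k n T p s \<longrightarrow>
      (\<forall>t<T. \<forall>a<n.
        measure M {\<omega> \<in> space M. \<bar>cumulative p t a - count_at_prediction k P \<omega> p s t a\<bar> \<le> \<beta>} \<ge> q))"

definition expected_messages ::
  "'w measure \<Rightarrow> nat \<Rightarrow> ('w, 'm) protocol \<Rightarrow> nat \<Rightarrow> payoffs \<Rightarrow> queries \<Rightarrow> ennreal" where
  "expected_messages M k P T p s = (\<integral>\<^sup>+ \<omega>. of_nat (messages k P T p s \<omega>) \<partial>M)"

end

theory Submission
  imports Defs
begin

text \<open>
  In both parts the adversary cuts time into blocks, queries distinct sites within a block, keeps the
  payoffs constant on each block and draws their block values independently at random.  The
  expectation over the adversary's choice is a sum over all block values.

  For the regret, blocks have length about \<open>\<beta>\<close>, one of two experts gets payoff 1 in each block, and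
  the counter reports the counts at the start of the current block.  Decisions then carry no
  information on the current block and collect \<open>T / 2\<close> on average, whereas the better expert exceeds
  \<open>T / 2\<close> by \<open>\<beta>\<close> times the mean displacement of a random walk with \<open>T / \<beta>\<close> steps.

  For the communication, blocks have length \<open>k\<close> and the payoff is 0, 1/2 or 1 throughout a block.
  Late in a block the three true counts are further apart than the accuracy allows, while a site
  that has received no message during the block has the same view in all cases.  Being accurate with
  probability 1/2 on each of three values, it must receive a message with constant probability.
\<close>

section \<open>Averaging over block values\<close>

text \<open>Replaces conditioning on all blocks but one: a single block value is redrawn uniformly
  while the others are held fixed.\<close>

lemma sum_PiE_resample:
  fixes f :: "('i \<Rightarrow> 'a) \<Rightarrow> 'b::comm_semiring_1"
  assumes "j \<in> I"
  shows "(\<Sum>x\<in>I \<rightarrow>\<^sub>E D. \<Sum>v\<in>D. f (x(j := v))) = of_nat (card D) * (\<Sum>x\<in>I \<rightarrow>\<^sub>E D. f x)"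
proof -
  \<comment> \<open>Exchanging \<open>x j\<close> with the spare value \<open>v\<close> is an
    involution, hence its own inverse, and turns \<open>f (x(j := v))\<close> into
    \<open>f x\<close>.\<close>
  let ?swap = "\<lambda>(x :: 'i \<Rightarrow> 'a, v). (x(j := v), x j)"
  have "(\<Sum>x\<in>I \<rightarrow>\<^sub>E D. \<Sum>v\<in>D. f (x(j := v))) = (\<Sum>(x, v)\<in>(I \<rightarrow>\<^sub>E D) \<times> D. f (x(j := v)))"
    by (rule sum.cartesian_product)
  also have "\<dots> = (\<Sum>(x, v)\<in>(I \<rightarrow>\<^sub>E D) \<times> D. f x)"
    by (rule sum.reindex_bij_witness[where i = ?swap and j = ?swap])
      (use assms in \<open>auto simp: PiE_iff extensional_def\<close>)
  also have "\<dots> = (\<Sum>x\<in>I \<rightarrow>\<^sub>E D. \<Sum>v\<in>D. f x)"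
    by (rule sum.cartesian_product[symmetric])
  finally show ?thesis
    by (simp add: sum_distrib_left)
qed

lemma sum_PiE_lessThan_Suc:
  fixes f :: "(nat \<Rightarrow> 'a) \<Rightarrow> 'b::comm_monoid_add"
  shows "(\<Sum>x\<in>{..<Suc n} \<rightarrow>\<^sub>E D. f x) = (\<Sum>v\<in>D. \<Sum>x\<in>{..<n} \<rightarrow>\<^sub>E D. f (x(n := v)))"
proof -
  have "(\<Sum>x\<in>{..<Suc n} \<rightarrow>\<^sub>E D. f x) = (\<Sum>(v, x)\<in>D \<times> ({..<n} \<rightarrow>\<^sub>E D). f (x(n := v)))"
    unfolding lessThan_Suc PiE_insert_eq
    by (subst sum.reindex) (auto intro!: inj_combinator simp: case_prod_beta)
  then show ?thesis
    by (simp add: sum.cartesian_product)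
qed

section \<open>Moments of the simple random walk\<close>

definition signs :: "nat \<Rightarrow> (nat \<Rightarrow> real) set" where
  "signs B = {..<B} \<rightarrow>\<^sub>E {-1, 1}"

lemma finite_signs: "finite (signs B)"
  by (auto simp: signs_def intro: finite_PiE)

lemma card_signs: "card (signs B) = 2 ^ B"
  by (simp add: signs_def card_PiE flip: numeral_2_eq_2)

text \<open>Splitting off the last step of the walk gives a recursion for the even moments; odd
  powers cancel between the two signs.\<close>

lemma sum_signs_Suc:
  "(\<Sum>x\<in>signs (Suc B). g (\<Sum>j<Suc B. x j)) =
    (\<Sum>x\<in>signs B. g ((\<Sum>j<B. x j) + 1) + g ((\<Sum>j<B. x j) - 1))"
  for g :: "real \<Rightarrow> real"
  by (simp add: signs_def sum_PiE_lessThan_Suc sum.distrib add.commute)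

lemma second_moment_signs: "(\<Sum>x\<in>signs B. (\<Sum>j<B. x j)\<^sup>2) = real B * 2 ^ B"
proof (induction B)
  case (Suc B)
  have *: "(z + 1)\<^sup>2 + (z - 1)\<^sup>2 = 2 * z\<^sup>2 + 2" for z :: real
    by algebra
  show ?case
    unfolding sum_signs_Suc[of "\<lambda>z. z\<^sup>2"] *
    by (simp add: sum.distrib card_signs Suc flip: sum_distrib_left) (simp add: algebra_simps)
qed (simp add: signs_def)

lemma fourth_moment_signs:
  "(\<Sum>x\<in>signs B. (\<Sum>j<B. x j) ^ 4) = (3 * (real B)\<^sup>2 - 2 * real B) * 2 ^ B"
proof (induction B)
  case (Suc B)
  have *: "(z + 1) ^ 4 + (z - 1) ^ 4 = 2 * z ^ 4 + 12 * z\<^sup>2 + 2" for z :: real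
    by algebra
  show ?case
    unfolding sum_signs_Suc[of "\<lambda>z. z ^ 4"] *
    by (simp add: sum.distrib card_signs Suc second_moment_signs flip: sum_distrib_left)
      (simp add: algebra_simps power2_eq_square)
qed (simp add: signs_def)

text \<open>This turns the second and fourth moments into a lower bound for the first.\<close>

lemma abs_ge_second_minus_fourth:
  fixes z :: real
  assumes "\<sigma> > 0"
  shows "\<bar>z\<bar> \<ge> 3 / (4 * \<sigma>) * z\<^sup>2 - 1 / (12 * \<sigma> ^ 3) * z ^ 4"
proof -
  define y where "y = \<bar>z\<bar> / \<sigma>"
  have y: "y \<ge> 0" "\<bar>z\<bar> = \<sigma> * y"
    using assms by (auto simp: y_def)
  \<comment> \<open>Divided by \<sigma> y / 12, the claim reads
    \<open>12 - 9 * y + y ^ 3 \<ge> 0\<close>. The left side is smallest at the square root of 3,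
    for which 7/4 is a rational stand-in; the factor with 7/2 cancels the quadratic term.\<close>
  have "(y - 7/4)\<^sup>2 * (y + 7/2) \<ge> 0"
    using y by simp
  moreover have "12 - 9 * y + y ^ 3 = (y - 7/4)\<^sup>2 * (y + 7/2) + 3 / 16 * y + 41 / 32"
    by (simp add: power2_eq_square power3_eq_cube field_simps)
  ultimately have "12 - 9 * y + y ^ 3 \<ge> 0"
    using y by simp
  then have "y * (12 - 9 * y + y ^ 3) \<ge> 0"
    using y by simp
  then have "\<sigma> * (y - 3 / 4 * y\<^sup>2 + y ^ 4 / 12 ) \<ge> 0"
    using assms by (intro mult_nonneg_nonneg) (auto simp: power2_eq_square power3_eq_cube power4_eq_xxxx algebra_simps)
  moreover have "z\<^sup>2 = \<sigma>\<^sup>2 * y\<^sup>2" "z ^ 4 = \<sigma> ^ 4 * y ^ 4"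
    by (metis power2_abs power_mult_distrib y(2), metis power_even_abs_numeral even_numeral power_mult_distrib y(2))
  ultimately show ?thesis
    using assms y
    by (simp add: power2_eq_square power3_eq_cube power4_eq_xxxx field_simps)
qed

text \<open>With \<sigma> the square root of \<open>B\<close>, the polynomial bound has mean 3
  \<sigma> / 4 - \<sigma> / 4 + 1 / (6 \<sigma>), which exceeds \<sigma> / 2.\<close>

lemma first_moment_signs: "(\<Sum>x\<in>signs B. \<bar>\<Sum>j<B. x j\<bar>) \<ge> sqrt (real B) / 2 * 2 ^ B"
proof (cases "B = 0")
  case False
  define \<sigma> where "\<sigma> = sqrt (real B)"
  have \<sigma>: "\<sigma> > 0" "real B = \<sigma>\<^sup>2"
    using False by (auto simp: \<sigma>_def)
  have "\<sigma> / 2 \<le> 3 / (4 * \<sigma>) * \<sigma>\<^sup>2 - 1 / (12 * \<sigma> ^ 3) * (3 * (\<sigma>\<^sup>2)\<^sup>2 - 2 * \<sigma>\<^sup>2)"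
    using \<sigma>(1) by (simp add: power2_eq_square power3_eq_cube field_simps)
  then have "\<sigma> / 2 * 2 ^ B \<le>
      (3 / (4 * \<sigma>) * \<sigma>\<^sup>2 - 1 / (12 * \<sigma> ^ 3) * (3 * (\<sigma>\<^sup>2)\<^sup>2 - 2 * \<sigma>\<^sup>2)) * 2 ^ B"
    by (rule mult_right_mono) simp
  also have "\<dots> = 3 / (4 * \<sigma>) * (\<sigma>\<^sup>2 * 2 ^ B) - 1 / (12 * \<sigma> ^ 3) * ((3 * (\<sigma>\<^sup>2)\<^sup>2 - 2 * \<sigma>\<^sup>2) * 2 ^ B)"
    by (simp only: left_diff_distrib mult.assoc)
  also have "\<dots> = 3 / (4 * \<sigma>) * (\<Sum>x\<in>signs B. (\<Sum>j<B. x j)\<^sup>2)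
      - 1 / (12 * \<sigma> ^ 3) * (\<Sum>x\<in>signs B. (\<Sum>j<B. x j) ^ 4)"
    by (simp only: second_moment_signs fourth_moment_signs \<sigma>(2))
  also have "\<dots> = (\<Sum>x\<in>signs B. 3 / (4 * \<sigma>) * (\<Sum>j<B. x j)\<^sup>2 - 1 / (12 * \<sigma> ^ 3) * (\<Sum>j<B. x j) ^ 4)"
    by (simp only: sum_distrib_left sum_subtractf)
  also have "\<dots> \<le> (\<Sum>x\<in>signs B. \<bar>\<Sum>j<B. x j\<bar>)"
    by (intro sum_mono abs_ge_second_minus_fourth \<sigma>)
  finally show ?thesis
    by (simp add: \<sigma>_def)
qed simp

section \<open>Payoffs that are constant on blocks\<close>

lemma sum_div_blocks:
  fixes g :: "nat \<Rightarrow> real"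
  assumes "0 < m" "l \<le> m"
  shows "(\<Sum>t<m * j + l. g (t div m)) = real m * (\<Sum>i<j. g i) + real l * g j"
  using assms(2)
proof (induction j arbitrary: l)
  case 0
  then show ?case
    by (simp add: sum.cong)
next
  case (Suc j)
  from Suc.prems show ?case
  proof (induction l)
    \<comment> \<open>Zero steps into block \<open>Suc j\<close> is the same time as
      \<open>m\<close> steps into block \<open>j\<close>; this is why \<open>l \<le> m\<close> is
      allowed rather than \<open>l < m\<close>.\<close>
    case 0
    then show ?case
      using Suc.IH[of m] by (simp add: algebra_simps)
  next
    case (Suc l)
    then have "(m * Suc j + l) div m = Suc j"
      by (intro div_nat_eqI) auto
    then show ?case
      using Suc by (simp add: algebra_simps)
  qed
qed

text \<open>Paying 0 after the last whole block keeps the incomplete rest of the horizon out of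
  every sum. The restriction to \<open>{..<n}\<close> supplies the extensionality that
  \<open>adversary\<close> demands.\<close>

definition block_payoffs ::
  "nat \<Rightarrow> nat \<Rightarrow> nat \<Rightarrow> (nat \<Rightarrow> real \<Rightarrow> real) \<Rightarrow> (nat \<Rightarrow> real) \<Rightarrow> payoffs" where
  "block_payoffs n m B f x t = (\<lambda>a\<in>{..<n}. if t < m * B then f a (x (t div m)) else 0)"

lemma block_payoffs_apply:
  "a < n \<Longrightarrow> block_payoffs n m B f x t a = (if t < m * B then f a (x (t div m)) else 0)"
  by (simp add: block_payoffs_def)

lemma block_payoffs_cong:
  "(t < m * B \<Longrightarrow> x (t div m) = y (t div m)) \<Longrightarrow> block_payoffs n m B f x t = block_payoffs n m B f y t"
  by (auto simp: block_payoffs_def intro!: restrict_ext)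

text \<open>Round-robin queries \<open>t mod m\<close> visit each site below \<open>m\<close> once
  per block, and \<open>m \<le> k\<close> makes these legal sites.\<close>

lemma adversary_block_payoffs:
  assumes "0 < m" "m \<le> k" "x \<in> {..<B} \<rightarrow>\<^sub>E D" "\<And>a v. v \<in> D \<Longrightarrow> f a v \<in> {0..1}"
  shows "adversary k n T (block_payoffs n m B f x) (\<lambda>t. t mod m)"
  unfolding adversary_def
proof (intro allI impI conjI)
  fix t
  show "t mod m < k"
    using assms(1,2) by (meson mod_less_divisor less_le_trans)
  have "f a (x (t div m)) \<in> {0..1}" if "t < m * B" for a
  proof -
    have "t div m < B"
      using that by (simp add: less_mult_imp_div_less mult.commute)
    then show ?thesis
      using assms(3,4) by blast
  qed
  then show "block_payoffs n m B f x t \<in> {..<n} \<rightarrow>\<^sub>E {0..1}"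
    by (auto simp: block_payoffs_def)
qed

lemma cumulative_block_payoffs:
  assumes "0 < m" "a < n" "l \<le> m" "m * j + l \<le> m * B"
  shows "cumulative (block_payoffs n m B f x) (m * j + l) a =
    real m * (\<Sum>i<j. f a (x i)) + real l * f a (x j)"
proof -
  have "cumulative (block_payoffs n m B f x) (m * j + l) a = (\<Sum>t<m * j + l. f a (x (t div m)))"
    unfolding cumulative_def using assms by (intro sum.cong) (auto simp: block_payoffs_apply)
  then show ?thesis
    using sum_div_blocks[OF assms(1,3), of "\<lambda>i. f a (x i)" j] by simp
qed

lemma sum_block_payoffs:
  assumes "0 < m" "a < n" "m * B \<le> T"
  shows "(\<Sum>t<T. block_payoffs n m B f x t a) = real m * (\<Sum>i<B. f a (x i))"
proof -
  have "(\<Sum>t<T. block_payoffs n m B f x t a) = (\<Sum>t<m * B. block_payoffs n m B f x t a)"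
    using assms by (intro sum.mono_neutral_right) (auto simp: block_payoffs_apply)
  then show ?thesis
    using cumulative_block_payoffs[of m a n 0 B B f x] assms by (simp add: cumulative_def)
qed

text \<open>The rest after the last whole block is shorter than a block, and
  \<open>m \<le> T\<close> guarantees a whole block, so the blocks cover at least half of the
  horizon.\<close>

lemma block_count_ge:
  assumes "0 < m" "m \<le> T"
  shows "real T \<le> 2 * (real m * real (T div m))"
proof -
  have "T < m * (T div m) + m"
    using assms(1) by (metis add.commute dividend_less_div_times mult.commute)
  moreover have "m \<le> m * (T div m)"
    using assms by (simp add: div_greater_zero_iff Suc_leI)
  ultimately have "T \<le> 2 * (m * (T div m))"
    by linarith
  then have "real T \<le> real (2 * (m * (T div m)))"
    by (rule of_nat_mono)
  then show ?thesis
    by simp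
qed

section \<open>Regret\<close>

definition block_counter :: "nat \<Rightarrow> nat \<Rightarrow> counter" where
  "block_counter n m p s i t = (\<lambda>a\<in>{..<n}. cumulative p (m * (t div m)) a)"

text \<open>At step \<open>t\<close> the counter misses the \<open>t mod m\<close> payoffs already
  revealed in the current block, at most m - 1 of them, and each lies in [0, 1].\<close>

lemma approximate_block_counter:
  assumes "0 < m" "real m - 1 \<le> \<beta>"
  shows "approximate_counter k n T \<beta> (block_counter n m)"
  unfolding approximate_counter_def
proof (intro conjI allI impI)
  show "causal (block_counter n m)"
    unfolding causal_def
  proof (intro allI impI)
    fix p p' :: payoffs and s s' :: queries and i t
    assume eq: "\<forall>\<tau><t. p \<tau> = p' \<tau>"
    have "m * (t div m) \<le> t"
      by simp
    with eq show "block_counter n m p s i t = block_counter n m p' s' i t"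
      unfolding block_counter_def cumulative_def
      by (intro restrict_ext sum.cong refl) (metis lessThan_iff less_le_trans)
  qed
next
  fix p s t i a
  assume adv: "adversary k n T p s" and "t < T" and "a < n"
  have *: "p \<tau> a \<in> {0..1}" if "\<tau> < t" for \<tau>
    using adv \<open>t < T\<close> \<open>a < n\<close> that by (auto simp: adversary_def PiE_iff dest: less_trans)
  have "cumulative p t a - cumulative p (m * (t div m)) a = (\<Sum>\<tau>\<in>{m * (t div m)..<t}. p \<tau> a)"
    unfolding cumulative_def lessThan_atLeast0 by (rule sum_diff_nat_ivl) auto
  moreover have "(\<Sum>\<tau>\<in>{m * (t div m)..<t}. p \<tau> a) \<ge> 0"
    using * by (intro sum_nonneg) auto
  moreover have "(\<Sum>\<tau>\<in>{m * (t div m)..<t}. p \<tau> a) \<le> (\<Sum>\<tau>\<in>{m * (t div m)..<t}. 1)"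
    using * by (intro sum_mono) auto
  moreover have "real (t - m * (t div m)) \<le> real m - 1"
    using mod_less_divisor[OF assms(1), of t] by (simp add: minus_mult_div_eq_mod)
  ultimately show "\<bar>cumulative p t a - block_counter n m p s i t a\<bar> \<le> \<beta>"
    using assms(2) \<open>a < n\<close> by (simp add: block_counter_def)
qed (simp add: block_counter_def)

text \<open>For values 1 and -1 the first two experts share a payoff of 1 and differ by
  \<open>v\<close>, so the gap between their totals is the walk scaled by the block length. Further
  experts get nothing, which reduces any \<open>n\<close> to two experts.\<close>

definition opposite :: "nat \<Rightarrow> real \<Rightarrow> real" where
  "opposite a v = (if a = 0 then (1 + v) / 2 else if a = 1 then (1 - v) / 2 else 0)"

text \<open>
  A site is queried at most once per block and its counts ignore the current block, so a decision
  is independent of the value of the block in which it is made.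
\<close>

lemma chosen_block_update:
  assumes "0 < m"
  shows "chosen A (block_counter n m) (block_payoffs n m B f (x(t div m := v))) (\<lambda>t. t mod m) \<omega> t =
    chosen A (block_counter n m) (block_payoffs n m B f x) (\<lambda>t. t mod m) \<omega> t"
proof -
  let ?y = "x(t div m := v)"
  have eq: "block_payoffs n m B f ?y \<tau> = block_payoffs n m B f x \<tau>" if "\<tau> div m < t div m" for \<tau>
    using that by (intro block_payoffs_cong) auto
  \<comment> \<open>Two distinct times that are congruent modulo \<open>m\<close> cannot share a
    block.\<close>
  have "\<tau> div m < t div m" if "\<tau> < t" "\<tau> mod m = t mod m" for \<tau>
    using that by (metis div_le_mono div_mult_mod_eq le_neq_implies_less less_imp_le_nat nat_neq_iff)
  then have "map (\<lambda>\<tau>. (\<tau>, block_payoffs n m B f ?y \<tau>)) (filter (\<lambda>\<tau>. \<tau> mod m = t mod m) [0..<t]) =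
      map (\<lambda>\<tau>. (\<tau>, block_payoffs n m B f x \<tau>)) (filter (\<lambda>\<tau>. \<tau> mod m = t mod m) [0..<t])"
    using eq by simp
  moreover have "block_counter n m (block_payoffs n m B f ?y) s i u =
      block_counter n m (block_payoffs n m B f x) s i u" if "u \<le> t" for u s i
  proof -
    have "\<tau> div m < t div m" if "\<tau> < m * (u div m)" for \<tau>
      using that div_le_mono[OF \<open>u \<le> t\<close>, of m]
      by (metis less_le_trans less_mult_imp_div_less mult.commute)
    then show ?thesis
      using eq by (simp add: block_counter_def cumulative_def)
  qed
  then have "map (block_counter n m (block_payoffs n m B f ?y) s i) [0..<Suc t] =
      map (block_counter n m (block_payoffs n m B f x) s i) [0..<Suc t]" for s i
    by (intro map_cong) auto
  ultimately show ?thesis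
    unfolding chosen_def site_information_def by (simp only:)
qed

text \<open>Probabilistic method: averaged over all sign sequences, the algorithm gains at most
  mB/2, while the best expert gets at least mB/2 plus m/2 times the mean displacement of the walk.
  Small regret on every sequence would contradict these averages.\<close>

lemma block_regret:
  assumes m: "0 < m" "m \<le> k" "m * B \<le> T" and n: "2 \<le> n" and A: "decision_algorithm M n A"
  shows "\<exists>p s. adversary k n T p s \<and>
    expected_regret M A (block_counter n m) n T p s \<ge> real m * sqrt (real B) / 4"
proof (rule ccontr)
  let ?p = "block_payoffs n m B opposite" and ?s = "\<lambda>t. t mod m"
  define gain where "gain x \<omega> t = ?p x t (chosen A (block_counter n m) (?p x) ?s \<omega> t)" for x \<omega> t
  define best where "best x = (MAX a\<in>{..<n}. \<Sum>t<T. ?p x t a)" for x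
  assume contra: "\<not> ?thesis"
  interpret prob_space M
    using A by (simp add: decision_algorithm_def)
  have adv: "adversary k n T (?p x) ?s" if "x \<in> signs B" for x
    using that unfolding signs_def
    by (rule adversary_block_payoffs[OF m(1,2)]) (auto simp: opposite_def)
  have decision: "(\<lambda>\<omega>. A \<omega> i t h) \<in> M \<rightarrow>\<^sub>M count_space {..<n}" for i t h
    using A unfolding decision_algorithm_def by blast
  have chosen_less: "chosen A C p s \<omega> t < n" if "\<omega> \<in> space M" for C p s \<omega> t
    using measurable_space[OF decision that] by (simp add: chosen_def)
  have gain_bound: "0 \<le> gain x \<omega> t \<and> gain x \<omega> t \<le> 1"
    if "x \<in> signs B" "\<omega> \<in> space M" "t < T" for x \<omega> t
    using adv[OF that(1)] chosen_less[OF that(2)] that(3)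
    by (auto simp: adversary_def gain_def PiE_iff)
  have gain_integrable: "integrable M (\<lambda>\<omega>. gain x \<omega> t)" if "x \<in> signs B" "t < T" for x t
  proof (rule integrable_const_bound)
    show "AE \<omega> in M. norm (gain x \<omega> t) \<le> 1"
      using gain_bound[OF that(1) _ that(2)] by (auto intro!: AE_I2)
    show "(\<lambda>\<omega>. gain x \<omega> t) \<in> borel_measurable M"
      unfolding gain_def chosen_def by (rule measurable_compose[OF decision]) simp
  qed
  \<comment> \<open>This holds for each \<omega> separately, so the average over sequences can be
    taken inside the integral over the algorithm's randomness.\<close>
  have gain_total: "(\<Sum>x\<in>signs B. \<Sum>t<T. gain x \<omega> t) \<le> 2 ^ B * (real m * real B / 2)"
    if \<omega>: "\<omega> \<in> space M" for \<omega>
  proof -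
    have *: "(\<Sum>x\<in>signs B. gain x \<omega> t) \<le> (if t < m * B then 2 ^ B / 2 else 0)" if "t < T" for t
    proof (cases "t < m * B")
      case True
      then have "t div m < B"
        by (simp add: less_mult_imp_div_less mult.commute)
      then have "2 * (\<Sum>x\<in>signs B. gain x \<omega> t) =
          (\<Sum>x\<in>signs B. \<Sum>v\<in>{-1, 1}. gain (x(t div m := v)) \<omega> t)"
        unfolding signs_def by (subst sum_PiE_resample) auto
      also have "\<dots> \<le> (\<Sum>x\<in>signs B. 1)"
      proof (rule sum_mono)
        fix x
        \<comment> \<open>The same expert is chosen for both values of the block; its two payoffs
          add up to 1 for experts 0 and 1, and to 0 otherwise.\<close>
        show "(\<Sum>v\<in>{-1, 1}. gain (x(t div m := v)) \<omega> t) \<le> 1"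
          using True chosen_less[OF \<omega>]
          by (simp add: gain_def chosen_block_update[OF m(1)] block_payoffs_apply opposite_def)
      qed
      finally show ?thesis
        using True by (simp add: card_signs)
    next
      case False
      then show ?thesis
        using chosen_less[OF \<omega>] by (simp add: gain_def block_payoffs_apply)
    qed
    have "(\<Sum>x\<in>signs B. \<Sum>t<T. gain x \<omega> t) = (\<Sum>t<T. \<Sum>x\<in>signs B. gain x \<omega> t)"
      by (rule sum.swap)
    also have "\<dots> \<le> (\<Sum>t<T. if t < m * B then 2 ^ B / 2 else 0)"
      using * by (intro sum_mono) auto
    also have "\<dots> = (\<Sum>t<m * B. 2 ^ B / 2)"
      using m by (intro sum.mono_neutral_cong_right) auto
    finally show ?thesis
      by (simp add: algebra_simps)
  qed
  have best_ge: "best x \<ge> real m * real B / 2 + real m / 2 * \<bar>\<Sum>j<B. x j\<bar>" for x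
  proof -
    have "best x \<ge> (\<Sum>t<T. ?p x t a)" if "a < n" for a
      unfolding best_def using that by (intro Max_ge) auto
    then have "best x \<ge> real m * (\<Sum>j<B. opposite a (x j))" if "a < n" for a
      using that sum_block_payoffs[OF m(1) that m(3)] by metis
    \<comment> \<open>Experts 0 and 1 total mB/2 plus and minus m/2 times the walk; the larger of
      the two carries the absolute value.\<close>
    from this[of 0] this[of 1] n show ?thesis
      by (simp add: opposite_def sum.distrib sum_subtractf abs_if
          add_divide_distrib diff_divide_distrib algebra_simps flip: sum_divide_distrib)
  qed
  have "2 ^ B * (real m * sqrt (real B) / 4) \<le> real m / 2 * (\<Sum>x\<in>signs B. \<bar>\<Sum>j<B. x j\<bar>)"
    using mult_left_mono[OF first_moment_signs[of B], of "real m / 2"] by (simp add: algebra_simps)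
  also have "\<dots> = (\<Sum>x\<in>signs B. real m * real B / 2 + real m / 2 * \<bar>\<Sum>j<B. x j\<bar>)
      - 2 ^ B * (real m * real B / 2)"
    by (simp only: sum.distrib sum_distrib_left[symmetric]) (simp add: card_signs)
  also have "\<dots> \<le> (\<Sum>x\<in>signs B. best x) - 2 ^ B * (real m * real B / 2)"
    by (intro diff_right_mono sum_mono best_ge)
  also have "\<dots> = (LINT \<omega>|M. (\<Sum>x\<in>signs B. best x) - 2 ^ B * (real m * real B / 2))"
    by (simp add: prob_space)
  also have "\<dots> \<le> (LINT \<omega>|M. (\<Sum>x\<in>signs B. best x - (\<Sum>t<T. gain x \<omega> t)))"
    using gain_total gain_integrable
    by (intro integral_mono Bochner_Integration.integrable_sum Bochner_Integration.integrable_diff)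
       (auto simp: sum_subtractf)
  also have "\<dots> = (\<Sum>x\<in>signs B. (LINT \<omega>|M. best x - (\<Sum>t<T. gain x \<omega> t)))"
    using gain_integrable
    by (intro Bochner_Integration.integral_sum Bochner_Integration.integrable_sum
        Bochner_Integration.integrable_diff) auto
  also have "\<dots> = (\<Sum>x\<in>signs B. expected_regret M A (block_counter n m) n T (?p x) ?s)"
    by (simp add: expected_regret_def best_def gain_def)
  also have "\<dots> < (\<Sum>x\<in>signs B. real m * sqrt (real B) / 4)"
  proof (rule sum_strict_mono)
    show "signs B \<noteq> {}"
      using card_signs[of B] by auto
    show "expected_regret M A (block_counter n m) n T (?p x) ?s < real m * sqrt (real B) / 4"
      if "x \<in> signs B" for x
      using contra adv[OF that] by (meson not_le)
  qed (rule finite_signs)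
  finally show False
    by (simp add: card_signs)
qed

text \<open>The counter is fixed before the algorithm; only \<open>p\<close> and \<open>s\<close>
  respond to it. With B = T div m, the bounds \<beta> \<le> 2m and T \<le> 2mB give sqrt(\<beta> T)
  \<le> 2m sqrt(B), so m sqrt(B) / 4 is at least an eighth of sqrt(\<beta> T).\<close>

lemma regret_lower_bound:
  assumes k: "1 \<le> k" and n: "2 \<le> n" and \<beta>: "0 \<le> \<beta>" "\<beta> \<le> real k" "\<beta> \<le> real T"
  shows "\<exists>C. approximate_counter k n T \<beta> C \<and>
    (\<forall>(M :: 'w measure) A. decision_algorithm M n A \<longrightarrow>
      (\<exists>p s. adversary k n T p s \<and> expected_regret M A C n T p s \<ge> 1 / 8 * sqrt (\<beta> * real T)))"
proof -
  \<comment> \<open>For \<beta> < 1 blocks have length 1 and the counter is exact; otherwise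
    rounding down loses less than a factor of two.\<close>
  define m where "m = max 1 (nat \<lfloor>\<beta>\<rfloor>)"
  have m: "0 < m" "m \<le> k" "real m - 1 \<le> \<beta>" "\<beta> \<le> 2 * real m"
    using k \<beta> unfolding m_def by (auto simp: max_def; linarith)+
  have bound: "1 / 8 * sqrt (\<beta> * real T) \<le> real m * sqrt (real (T div m)) / 4"
  proof (cases "T = 0")
    case False
    then have "m \<le> T"
      using \<beta> unfolding m_def by (simp add: max_def) linarith
    then have "\<beta> * real T \<le> (2 * real m) * (2 * (real m * real (T div m)))"
      using block_count_ge[OF m(1)] m \<beta> by (intro mult_mono) auto
    also have "\<dots> = (2 * real m * sqrt (real (T div m)))\<^sup>2"
      by (simp add: power2_eq_square)
    finally have "sqrt (\<beta> * real T) \<le> 2 * real m * sqrt (real (T div m))"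
      by (rule real_le_lsqrt[rotated]) simp
    then show ?thesis
      by simp
  qed simp
  have "m * (T div m) \<le> T"
    by simp
  from block_regret[OF m(1,2) this n] bound show ?thesis
    using approximate_block_counter[OF m(1,3), of k n T] by (meson order_trans)
qed

section \<open>Communication\<close>

definition receipts :: "'m view \<Rightarrow> nat" where
  "receipts v = length (filter (\<lambda>(c, e). \<exists>w m. e = Receive w m) v)"

lemma receipts_append: "receipts (v @ w) = receipts v + receipts w"
  by (simp add: receipts_def)

lemma receipts_Nil: "receipts [] = 0"
  by (simp add: receipts_def)

text \<open>A fragment of this kind is empty once its receipt count is 0; this turns a count of
  receipts into knowledge of the whole view.\<close>

definition only_receipts :: "'m view \<Rightarrow> bool" where
  "only_receipts v \<longleftrightarrow> receipts v = length v"

lemma exchange_extends: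
  "\<exists>R. only_receipts R \<and> exchange k P \<omega> t b r V u = V u @ R"
proof (induction r)
  case 0
  show ?case
    by (simp add: only_receipts_def receipts_Nil)
next
  case (Suc r)
  have "only_receipts (inbox k P \<omega> c W u)" for c W
    unfolding only_receipts_def receipts_def inbox_def
    by (subst filter_True) (auto split: option.splits)
  moreover obtain R where "only_receipts R" "exchange k P \<omega> t b r V u = V u @ R"
    using Suc by blast
  ultimately show ?case
    by (intro exI[of _ "R @ inbox k P \<omega> (t, b, r) (exchange k P \<omega> t b r V) u"])
      (simp add: Let_def only_receipts_def receipts_append)
qed

lemma before_prediction_extends:
  "\<exists>R. only_receipts R \<and>
    before_prediction k P \<omega> s t V (Site (s t)) = V (Site (s t)) @ [((t, False, 0), Query)] @ R"
  using exchange_extends[of k P \<omega> t False "rounds P \<omega> t"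
      "observe (Site (s t)) (t, False, 0) Query V" "Site (s t)"]
  by (auto simp: before_prediction_def observe_def)

lemma before_prediction_unqueried:
  assumes "u \<noteq> Site (s t)"
  shows "\<exists>R. only_receipts R \<and> before_prediction k P \<omega> s t V u = V u @ R"
  using exchange_extends[of k P \<omega> t False "rounds P \<omega> t" "observe (Site (s t)) (t, False, 0) Query V" u]
    assms by (simp add: before_prediction_def observe_def)

lemma after_prediction_unqueried:
  assumes "u \<noteq> Site (s t)"
  shows "\<exists>R. only_receipts R \<and> after_prediction k P \<omega> p s t V u = V u @ R"
  using exchange_extends[of k P \<omega> t True "rounds P \<omega> t"
      "observe (Site (s t)) (t, True, 0) (Reveal (p t)) V" u]
    assms by (simp add: after_prediction_def observe_def)

lemma views_Suc_unqueried:
  assumes "u \<noteq> Site (s t)"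
  shows "\<exists>R. only_receipts R \<and> views k P \<omega> p s (Suc t) u = views k P \<omega> p s t u @ R"
proof -
  obtain R where R: "only_receipts R"
    "before_prediction k P \<omega> s t (views k P \<omega> p s t) u = views k P \<omega> p s t u @ R"
    using before_prediction_unqueried[of u s t k P \<omega> "views k P \<omega> p s t", OF assms] by blast
  obtain R' where "only_receipts R'"
    "views k P \<omega> p s (Suc t) u = before_prediction k P \<omega> s t (views k P \<omega> p s t) u @ R'"
    using after_prediction_unqueried[of u s t k P \<omega> p "before_prediction k P \<omega> s t (views k P \<omega> p s t)", OF assms] by auto
  with R show ?thesis
    by (auto simp: only_receipts_def receipts_append intro!: exI[of _ "R @ R'"])
qed

text \<open>Queries and revealed payoffs reach only the queried site, so every other node learns
  through messages alone.\<close>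

lemma views_unqueried:
  assumes "\<And>\<tau>. t0 \<le> \<tau> \<Longrightarrow> \<tau> < t0 + l \<Longrightarrow> u \<noteq> Site (s \<tau>)"
  shows "\<exists>R. only_receipts R \<and> views k P \<omega> p s (t0 + l) u = views k P \<omega> p s t0 u @ R"
  using assms
proof (induction l)
  case 0
  show ?case
    by (simp add: only_receipts_def receipts_Nil)
next
  case (Suc l)
  obtain R where R: "only_receipts R" "views k P \<omega> p s (t0 + l) u = views k P \<omega> p s t0 u @ R"
    using Suc by auto
  obtain R' where "only_receipts R'"
    "views k P \<omega> p s (Suc (t0 + l)) u = views k P \<omega> p s (t0 + l) u @ R'"
    using views_Suc_unqueried[of u s "t0 + l" k P \<omega> p] Suc.prems[of "t0 + l"] by (auto simp del: views.simps)
  with R show ?case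
    by (auto simp: only_receipts_def receipts_append simp del: views.simps intro!: exI[of _ "R @ R'"])
qed

lemma receipts_before_prediction:
  "receipts (V u) \<le> receipts (before_prediction k P \<omega> s t V u)"
  using exchange_extends[of k P \<omega> t False "rounds P \<omega> t" "observe (Site (s t)) (t, False, 0) Query V" u]
  by (auto simp: before_prediction_def observe_def receipts_append split: if_splits)

lemma receipts_after_prediction:
  "receipts (V u) \<le> receipts (after_prediction k P \<omega> p s t V u)"
  using exchange_extends[of k P \<omega> t True "rounds P \<omega> t"
      "observe (Site (s t)) (t, True, 0) (Reveal (p t)) V" u]
  by (auto simp: after_prediction_def observe_def receipts_append split: if_splits)

lemma receipts_views_mono:
  "t \<le> t' \<Longrightarrow> receipts (views k P \<omega> p s t u) \<le> receipts (views k P \<omega> p s t' u)"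
  by (rule lift_Suc_mono_le)
    (auto intro: order_trans[OF receipts_before_prediction receipts_after_prediction])

lemma views_cong:
  "(\<And>\<tau>. \<tau> < t \<Longrightarrow> p \<tau> = p' \<tau>) \<Longrightarrow> views k P \<omega> p s t = views k P \<omega> p' s t"
  by (induction t) (auto simp: after_prediction_def)

section \<open>Informed sites and the number of messages\<close>

abbreviation view_at_prediction ::
  "nat \<Rightarrow> ('w, 'm) protocol \<Rightarrow> 'w \<Rightarrow> payoffs \<Rightarrow> queries \<Rightarrow> nat \<Rightarrow> 'm view" where
  "view_at_prediction k P \<omega> p s t \<equiv>
    before_prediction k P \<omega> s t (views k P \<omega> p s t) (Site (s t))"

text \<open>The receipts counted run from the start \<open>t0\<close> of the block up to the
  prediction, so messages exchanged after the query of step \<open>t\<close> are included.\<close>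

definition informed ::
  "nat \<Rightarrow> ('w, 'm) protocol \<Rightarrow> 'w \<Rightarrow> payoffs \<Rightarrow> queries \<Rightarrow> nat \<Rightarrow> nat \<Rightarrow> bool" where
  "informed k P \<omega> p s t0 t \<longleftrightarrow>
    receipts (view_at_prediction k P \<omega> p s t) > receipts (views k P \<omega> p s t0 (Site (s t)))"

text \<open>Rounds without a message leave no trace in a view, so such a site has seen nothing since
  \<open>t0\<close> but the present query.\<close>

lemma view_uninformed:
  assumes "\<And>\<tau>. t0 \<le> \<tau> \<Longrightarrow> \<tau> < t0 + l \<Longrightarrow> s \<tau> \<noteq> s (t0 + l)"
    and "\<not> informed k P \<omega> p s t0 (t0 + l)"
  shows "view_at_prediction k P \<omega> p s (t0 + l) =
    views k P \<omega> p s t0 (Site (s (t0 + l))) @ [((t0 + l, False, 0), Query)]"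
proof -
  let ?u = "Site (s (t0 + l))"
  obtain R where R: "only_receipts R" "views k P \<omega> p s (t0 + l) ?u = views k P \<omega> p s t0 ?u @ R"
    using views_unqueried[of t0 l ?u s k P \<omega> p] assms(1) by (metis node.inject)
  obtain R' where R': "only_receipts R'" "view_at_prediction k P \<omega> p s (t0 + l) =
      views k P \<omega> p s (t0 + l) ?u @ [((t0 + l, False, 0), Query)] @ R'"
    using before_prediction_extends[of k P \<omega> s "t0 + l" "views k P \<omega> p s (t0 + l)"] by blast
  have "R = [] \<and> R' = []"
    using assms(2) R R' by (auto simp: informed_def receipts_append only_receipts_def) (simp add: receipts_def)
  then show ?thesis
    using R R' by simp
qed

text \<open>Silence may itself depend on the payoffs, so the site has to be uninformed under both
  sequences. Its view is then the common past and the query, and for fixed \<omega> the estimate is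
  a function of that view.\<close>

lemma count_uninformed:
  assumes "\<And>\<tau>. t0 \<le> \<tau> \<Longrightarrow> \<tau> < t0 + l \<Longrightarrow> s \<tau> \<noteq> s (t0 + l)"
    and "\<And>\<tau>. \<tau> < t0 \<Longrightarrow> p \<tau> = p' \<tau>"
    and "\<not> informed k P \<omega> p s t0 (t0 + l)" "\<not> informed k P \<omega> p' s t0 (t0 + l)"
  shows "count_at_prediction k P \<omega> p s (t0 + l) = count_at_prediction k P \<omega> p' s (t0 + l)"
  using view_uninformed[OF assms(1,3)] view_uninformed[OF assms(1,4)] views_cong[of t0 p p' k P \<omega> s] assms(2)
  by (simp add: count_at_prediction_def)

text \<open>A site informed in block \<open>j\<close> receives a message within that block. Blocks
  are disjoint in time and views belong to single sites, so no message is counted twice; those to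
  the coordinator are dropped.\<close>

lemma messages_ge_informed:
  assumes "0 < k" "k * B \<le> T" "L \<subseteq> {..<k}"
  shows "(\<Sum>j<B. \<Sum>l\<in>L. of_bool (informed k P \<omega> p (\<lambda>t. t mod k) (k * j) (k * j + l)))
    \<le> messages k P T p (\<lambda>t. t mod k) \<omega>"
proof -
  let ?s = "\<lambda>t. t mod k"
  define rc where "rc l t = receipts (views k P \<omega> p ?s t (Site l))" for l t
  have step: "rc l (k * j) + of_bool (informed k P \<omega> p ?s (k * j) (k * j + l)) \<le> rc l (k * Suc j)"
    if "l < k" for l j
  proof -
    have s: "(k * j + l) mod k = l"
      using that by simp
    have "receipts (view_at_prediction k P \<omega> p ?s (k * j + l)) \<le> rc l (Suc (k * j + l))"
      using receipts_after_prediction using that by (auto simp: rc_def s)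
    also have "\<dots> \<le> rc l (k * Suc j)"
      unfolding rc_def using that by (intro receipts_views_mono) auto
    finally show ?thesis
      using receipts_views_mono[of "k * j" "k * Suc j" k P \<omega> p ?s "Site l"]
      using that by (auto simp: informed_def rc_def s)
  qed
  have "(\<Sum>j<b. of_bool (informed k P \<omega> p ?s (k * j) (k * j + l))) \<le> rc l (k * b)"
    if "l < k" for l b
  proof (induction b)
    case (Suc b)
    then show ?case
      using step[OF that, of b] by simp
  qed simp
  moreover have "rc l (k * B) \<le> rc l T" for l
    unfolding rc_def using assms(2) by (rule receipts_views_mono)
  ultimately have "(\<Sum>l\<in>L. \<Sum>j<B. of_bool (informed k P \<omega> p ?s (k * j) (k * j + l))) \<le> (\<Sum>l\<in>L. rc l T)"
    using assms(3) by (intro sum_mono) (meson lessThan_iff order_trans subsetD)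
  also have "\<dots> = (\<Sum>u\<in>Site ` L. receipts (views k P \<omega> p ?s T u))"
    by (subst sum.reindex) (auto simp: inj_on_def rc_def)
  also have "\<dots> \<le> messages k P T p ?s \<omega>"
    unfolding messages_def receipts_def using assms(3) by (intro sum_mono2) auto
  finally show ?thesis
    by (subst sum.swap)
qed

section \<open>Accuracy against communication\<close>

text \<open>Accuracy with probability 1/2 on three values gives 3/2 accurate values on average, more
  than the single one an uninformed site can serve. With two values both numbers would be 1.\<close>

definition levels :: "real set" where
  "levels = {0, 1 / 2, 1}"

lemma card_levels: "card levels = 3"
  by (simp add: levels_def)

abbreviation level_payoffs :: "nat \<Rightarrow> nat \<Rightarrow> nat \<Rightarrow> (nat \<Rightarrow> real) \<Rightarrow> payoffs" where
  "level_payoffs n m B \<equiv> block_payoffs n m B (\<lambda>_ v. v)"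

definition accurate ::
  "nat \<Rightarrow> ('w, 'm) protocol \<Rightarrow> 'w \<Rightarrow> payoffs \<Rightarrow> queries \<Rightarrow> nat \<Rightarrow> bool" where
  "accurate k P \<omega> p s t \<longleftrightarrow>
    \<bar>cumulative p t 0 - count_at_prediction k P \<omega> p s t 0\<bar> \<le> real k / 10"

text \<open>
  From the offset \<open>l > 2 k / 5\<close> on, the counts for two levels differ by more than twice the
  accuracy, so an uninformed site is accurate for at most one of the three levels.
\<close>

lemma accurate_levels_le:
  assumes "0 < n" "j < B" "l < k" "2 * k < 5 * l"
  defines "p \<equiv> \<lambda>x v. level_payoffs n k B (x(j := v))" and "s \<equiv> \<lambda>t. t mod k"
  shows "(\<Sum>v\<in>levels. of_bool (accurate k P \<omega> (p x v) s (k * j + l))) \<le>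
    1 + (\<Sum>v\<in>levels. of_bool (informed k P \<omega> (p x v) s (k * j) (k * j + l)) :: nat)"
proof -
  let ?acc = "\<lambda>v. accurate k P \<omega> (p x v) s (k * j + l)"
  let ?inf = "\<lambda>v. informed k P \<omega> (p x v) s (k * j) (k * j + l)"
  have fin: "finite levels"
    by (simp add: levels_def)
  have unique: "v = w" if "v \<in> levels" "w \<in> levels" "?acc v" "?acc w" "\<not> ?inf v" "\<not> ?inf w" for v w
  proof (rule ccontr)
    assume "v \<noteq> w"
    have unqueried: "s \<tau> \<noteq> s (k * j + l)" if "k * j \<le> \<tau>" "\<tau> < k * j + l" for \<tau>
    proof -
      obtain i where "\<tau> = k * j + i"
        using le_Suc_ex[OF \<open>k * j \<le> \<tau>\<close>] by blast
      with that(2) show ?thesis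
        using assms(3) by (simp add: s_def)
    qed
    have agree: "p x v \<tau> = p x w \<tau>" if "\<tau> < k * j" for \<tau>
    proof -
      have "\<tau> div k < j"
        using that by (simp add: less_mult_imp_div_less mult.commute)
      then show ?thesis
        unfolding p_def by (intro block_payoffs_cong) simp
    qed
    \<comment> \<open>Here \<open>c\<close> is the count common to both levels, so the two true
      counts lie within twice the accuracy of each other.\<close>
    have triangle: "\<bar>a - b\<bar> \<le> real k / 5"
      if "\<bar>a - c\<bar> \<le> real k / 10" "\<bar>b - c\<bar> \<le> real k / 10" for a b c
      using that by linarith
    have "count_at_prediction k P \<omega> (p x v) s (k * j + l) =
        count_at_prediction k P \<omega> (p x w) s (k * j + l)"
      using unqueried agree that(5,6) by (rule count_uninformed)
    moreover have "cumulative (p x u) (k * j + l) 0 = real k * (\<Sum>i<j. x i) + real l * u" for u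
    proof -
      have "k * j + l \<le> k * Suc j"
        using assms(3) by simp
      also have "\<dots> \<le> k * B"
        using assms(2) by (intro mult_le_mono2) simp
      finally have "cumulative (p x u) (k * j + l) 0 =
          real k * (\<Sum>i<j. (x(j := u)) i) + real l * (x(j := u)) j"
        using cumulative_block_payoffs[of k 0 n l j B "\<lambda>_ v. v" "x(j := u)"] assms(1,3)
        by (simp add: p_def)
      also have "(\<Sum>i<j. (x(j := u)) i) = (\<Sum>i<j. x i)"
        by (intro sum.cong) auto
      finally show ?thesis
        by simp
    qed
    then have "cumulative (p x v) (k * j + l) 0 - cumulative (p x w) (k * j + l) 0 = real l * (v - w)"
      by (simp add: right_diff_distrib)
    ultimately have "\<bar>real l * (v - w)\<bar> \<le> real k / 5"
      using \<open>?acc v\<close> \<open>?acc w\<close> unfolding accurate_def by (metis triangle)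
    \<comment> \<open>Levels are 1/2 apart, so the true counts differ by at least l / 2, which
      exceeds k / 5 by the choice of the offset.\<close>
    moreover have "\<bar>v - w\<bar> \<ge> 1 / 2"
      using that(1,2) \<open>v \<noteq> w\<close> by (auto simp: levels_def)
    from mult_left_mono[OF this, of "real l"] have "real l * \<bar>v - w\<bar> \<ge> real l * (1 / 2)"
      by simp
    ultimately show False
      using assms(4) by (simp add: abs_mult)
  qed
  have "finite {v \<in> levels. ?acc v \<and> \<not> ?inf v}"
    using fin by simp
  then have "card {v \<in> levels. ?acc v \<and> \<not> ?inf v} \<le> Suc 0"
  proof (rule card_le_Suc0_iff_eq[THEN iffD2], intro ballI)
    fix v w
    assume "v \<in> {v \<in> levels. ?acc v \<and> \<not> ?inf v}" "w \<in> {v \<in> levels. ?acc v \<and> \<not> ?inf v}"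
    then show "v = w"
      by (intro unique) simp_all
  qed
  then have "(\<Sum>v\<in>levels. of_bool (?acc v \<and> \<not> ?inf v) :: nat) \<le> 1"
    using fin by (simp add: Int_def sum_of_bool_eq)
  moreover have "(\<Sum>v\<in>levels. of_bool (?acc v) :: nat) \<le>
      (\<Sum>v\<in>levels. of_bool (?acc v \<and> \<not> ?inf v) + of_bool (?inf v))"
    by (intro sum_mono) auto
  ultimately show ?thesis
    by (simp add: sum.distrib)
qed

text \<open>For fixed \<omega>, redrawing the value of block \<open>j\<close> brings in the
  three-level bound for each late query, and informed queries are then charged to messages. The
  factor 3 is the number of levels and keeps the count in the natural numbers.\<close>

lemma accurate_total_le:
  assumes "0 < n" "0 < k" "k * B \<le> T"
  defines "s \<equiv> \<lambda>t. t mod k" and "X \<equiv> {..<B} \<rightarrow>\<^sub>E levels" and "L \<equiv> {l. l < k \<and> 2 * k < 5 * l}"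
  shows "3 * (\<Sum>x\<in>X. \<Sum>j<B. \<Sum>l\<in>L. of_bool (accurate k P \<omega> (level_payoffs n k B x) s (k * j + l))) \<le>
    3 ^ B * (B * card L) + 3 * (\<Sum>x\<in>X. messages k P T (level_payoffs n k B x) s \<omega>)"
proof -
  let ?acc = "\<lambda>x j l. of_bool (accurate k P \<omega> (level_payoffs n k B x) s (k * j + l)) :: nat"
  let ?inf = "\<lambda>x j l. of_bool (informed k P \<omega> (level_payoffs n k B x) s (k * j) (k * j + l)) :: nat"
  have swap: "(\<Sum>x\<in>X. \<Sum>j<B. \<Sum>l\<in>L. f x j l) = (\<Sum>j<B. \<Sum>l\<in>L. \<Sum>x\<in>X. f x j l)"
    for f :: "_ \<Rightarrow> _ \<Rightarrow> _ \<Rightarrow> nat"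
    by (subst sum.swap, subst (2) sum.swap) simp
  have cardX: "card X = 3 ^ B"
    by (simp add: X_def card_PiE card_levels)
  have block: "3 * (\<Sum>x\<in>X. ?acc x j l) \<le> 3 ^ B + 3 * (\<Sum>x\<in>X. ?inf x j l)"
    if "j < B" "l \<in> L" for j l
  proof -
    have resample: "3 * (\<Sum>x\<in>X. f x) = (\<Sum>x\<in>X. \<Sum>v\<in>levels. f (x(j := v)))" for f :: "_ \<Rightarrow> nat"
      unfolding X_def using that(1) by (subst sum_PiE_resample) (auto simp: card_levels)
    have "3 * (\<Sum>x\<in>X. ?acc x j l) \<le> (\<Sum>x\<in>X. 1 + (\<Sum>v\<in>levels. ?inf (x(j := v)) j l))"
      unfolding resample s_def using that assms(1) by (intro sum_mono accurate_levels_le) (auto simp: L_def)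
    then show ?thesis
      by (simp only: resample sum.distrib) (simp add: cardX)
  qed
  have "3 * (\<Sum>x\<in>X. \<Sum>j<B. \<Sum>l\<in>L. ?acc x j l) = (\<Sum>j<B. \<Sum>l\<in>L. 3 * (\<Sum>x\<in>X. ?acc x j l))"
    by (simp add: swap sum_distrib_left)
  also have "\<dots> \<le> (\<Sum>j<B. \<Sum>l\<in>L. 3 ^ B + 3 * (\<Sum>x\<in>X. ?inf x j l))"
    by (intro sum_mono block) auto
  also have "\<dots> = 3 ^ B * (B * card L) + 3 * (\<Sum>x\<in>X. \<Sum>j<B. \<Sum>l\<in>L. ?inf x j l)"
    by (simp add: sum.distrib swap flip: sum_distrib_left)
  also have "\<dots> \<le> 3 ^ B * (B * card L) + 3 * (\<Sum>x\<in>X. messages k P T (level_payoffs n k B x) s \<omega>)"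
    unfolding s_def using assms(2,3)
    by (intro add_mono mult_left_mono sum_mono messages_ge_informed) (auto simp: L_def)
  finally show ?thesis .
qed

text \<open>At least 3k/5 - 1 offsets qualify, and this is at least k/10 exactly when
  \<open>k \<ge> 2\<close>; for \<open>k = 1\<close> there is no such offset.\<close>

lemma card_late_offsets:
  assumes "2 \<le> k"
  shows "real k / 10 \<le> real (card {l. l < k \<and> 2 * k < 5 * l})"
proof -
  have "{l. l < k \<and> 2 * k < 5 * l} = {2 * k div 5 + 1..<k}"
    by auto
  then have "card {l. l < k \<and> 2 * k < 5 * l} = k - (2 * k div 5 + 1)"
    by simp
  moreover have "k \<le> 10 * (k - (2 * k div 5 + 1))"
    using assms by linarith
  ultimately show ?thesis
    by simp
qed

text \<open>Accuracy makes the tripled expected count of accurate late queries at least 3N/2, while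
  the pointwise count bounds it by \<open>N\<close> plus three times all expected messages. Their
  mean over block values is therefore at least a sixth of \<open>B * card L\<close>, hence at least
  T/120. The constant 1/240 leaves a factor of two, so strictness may be lost on the way.\<close>

lemma communication_lower_bound:
  fixes M :: "'w measure" and P :: "('w, 'm) protocol"
  assumes k: "2 \<le> k" and n: "2 \<le> n" and T: "k \<le> T"
    and P: "randomized_protocol M k n T P"
    and approx: "approximates_with_probability M k n T (real k / 10) (1 / 2) P"
  shows "\<exists>p s. adversary k n T p s \<and> expected_messages M k P T p s \<ge> ennreal (1 / 240 * real T)"
proof (rule ccontr)
  assume contra: "\<not> ?thesis"
  define B where "B = T div k"
  define s where "s = (\<lambda>t. t mod k)"
  define X where "X = {..<B} \<rightarrow>\<^sub>E levels"
  define L where "L = {l. l < k \<and> 2 * k < 5 * l}"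
  let ?p = "level_payoffs n k B"
  interpret prob_space M
    using P by (simp add: randomized_protocol_def)
  have finX: "finite X" "card X = 3 ^ B" "X \<noteq> {}"
    by (auto simp: X_def levels_def card_PiE PiE_eq_empty_iff simp flip: numeral_3_eq_3 intro: finite_PiE)
  have adv: "adversary k n T (?p x) s" if "x \<in> X" for x
    unfolding s_def
  proof (rule adversary_block_payoffs)
    show "x \<in> {..<B} \<rightarrow>\<^sub>E levels"
      using that by (simp only: X_def)
  qed (use k in \<open>auto simp: levels_def\<close>)
  have few: "expected_messages M k P T (?p x) s < ennreal (1 / 240 * real T)" if "x \<in> X" for x
    using contra adv[OF that] by (meson not_le)
  have messages_measurable [measurable]: "messages k P T (?p x) s \<in> M \<rightarrow>\<^sub>M count_space UNIV"
    if "x \<in> X" for x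
    using P adv[OF that] unfolding randomized_protocol_def by blast
  let ?A = "\<lambda>x j l. {\<omega> \<in> space M. accurate k P \<omega> (?p x) s (k * j + l)}"
  have accurate: "?A x j l \<in> sets M \<and> measure M (?A x j l) \<ge> 1 / 2"
    if "x \<in> X" "j < B" "l \<in> L" for x j l
  proof -
    have "k * j + l < k * Suc j"
      using that(3) by (simp add: L_def)
    also have "\<dots> \<le> k * B"
      using that(2) by (intro mult_le_mono2) simp
    also have "\<dots> \<le> T"
      by (simp add: B_def)
    finally have t: "k * j + l < T" .
    then have [measurable]: "(\<lambda>\<omega>. count_at_prediction k P \<omega> (?p x) s (k * j + l) 0) \<in> borel_measurable M"
      using P adv[OF that(1)] n unfolding randomized_protocol_def by simp
    have "?A x j l \<in> sets M"
      unfolding accurate_def by measurable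
    then show ?thesis
      using approx adv[OF that(1)] t n unfolding approximates_with_probability_def accurate_def by auto
  qed
  \<comment> \<open>The number of triples of a block assignment, a block and a late offset.\<close>
  define N where "N = 3 ^ B * (real B * real (card L))"
  have "ennreal (3 / 2 * N) \<le> 3 * (\<Sum>x\<in>X. \<Sum>j<B. \<Sum>l\<in>L. emeasure M (?A x j l))"
  proof -
    have "N / 2 = (\<Sum>x\<in>X. \<Sum>j<B. \<Sum>l\<in>L. 1 / 2)"
      by (simp add: N_def finX)
    also have "\<dots> \<le> (\<Sum>x\<in>X. \<Sum>j<B. \<Sum>l\<in>L. measure M (?A x j l))"
      using accurate by (intro sum_mono) auto
    finally have "ennreal (3 * (N / 2)) \<le> ennreal (3 * (\<Sum>x\<in>X. \<Sum>j<B. \<Sum>l\<in>L. measure M (?A x j l)))"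
      by (intro ennreal_leI mult_left_mono) auto
    then show ?thesis
      by (simp add: emeasure_eq_measure ennreal_mult sum_ennreal sum_nonneg)
  qed
  \<comment> \<open>The integral is taken in \<open>ennreal\<close> because only measurability, not
    integrability, of the message count is assumed.\<close>
  also have "\<dots> = (\<integral>\<^sup>+ \<omega>. 3 * (\<Sum>x\<in>X. \<Sum>j<B. \<Sum>l\<in>L. indicator (?A x j l) \<omega>) \<partial>M)"
  proof -
    have meas: "(\<lambda>\<omega>. indicator (?A x j l) \<omega> :: ennreal) \<in> borel_measurable M"
      if "x \<in> X" "j < B" "l \<in> L" for x j l
      using accurate[OF that] by (intro borel_measurable_indicator) blast
    have "(\<integral>\<^sup>+ \<omega>. 3 * (\<Sum>x\<in>X. \<Sum>j<B. \<Sum>l\<in>L. indicator (?A x j l) \<omega>) \<partial>M) =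
        3 * (\<integral>\<^sup>+ \<omega>. (\<Sum>x\<in>X. \<Sum>j<B. \<Sum>l\<in>L. indicator (?A x j l) \<omega>) \<partial>M)"
      by (intro nn_integral_cmult borel_measurable_sum meas) auto
    also have "\<dots> = 3 * (\<Sum>x\<in>X. \<integral>\<^sup>+ \<omega>. (\<Sum>j<B. \<Sum>l\<in>L. indicator (?A x j l) \<omega>) \<partial>M)"
      by (intro arg_cong[where f = "(*) 3"] nn_integral_sum borel_measurable_sum meas) auto
    also have "\<dots> = 3 * (\<Sum>x\<in>X. \<Sum>j<B. \<integral>\<^sup>+ \<omega>. (\<Sum>l\<in>L. indicator (?A x j l) \<omega>) \<partial>M)"
      by (intro arg_cong[where f = "(*) 3"] sum.cong refl nn_integral_sum borel_measurable_sum meas) auto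
    also have "\<dots> = 3 * (\<Sum>x\<in>X. \<Sum>j<B. \<Sum>l\<in>L. \<integral>\<^sup>+ \<omega>. indicator (?A x j l) \<omega> \<partial>M)"
      by (intro arg_cong[where f = "(*) 3"] sum.cong refl nn_integral_sum meas) auto
    also have "\<dots> = 3 * (\<Sum>x\<in>X. \<Sum>j<B. \<Sum>l\<in>L. emeasure M (?A x j l))"
      using accurate by (simp add: nn_integral_indicator)
    finally show ?thesis ..
  qed
  also have "\<dots> \<le> (\<integral>\<^sup>+ \<omega>. ennreal N + 3 * (\<Sum>x\<in>X. of_nat (messages k P T (?p x) s \<omega>)) \<partial>M)"
  proof (rule nn_integral_mono)
    fix \<omega> assume "\<omega> \<in> space M"
    have "(\<Sum>x\<in>X. \<Sum>j<B. \<Sum>l\<in>L. indicator (?A x j l) \<omega>) =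
        (of_nat (\<Sum>x\<in>X. \<Sum>j<B. \<Sum>l\<in>L. of_bool (accurate k P \<omega> (?p x) s (k * j + l))) :: ennreal)"
      using \<open>\<omega> \<in> space M\<close> by (simp add: indicator_def)
    moreover have "ennreal N = of_nat (3 ^ B * (B * card L))"
      by (simp add: N_def ennreal_of_nat_eq_real_of_nat)
    moreover have "0 < n" "0 < k" "k * B \<le> T"
      using n k by (auto simp: B_def)
    note of_nat_mono[OF accurate_total_le[OF this, of P \<omega>], where 'a = ennreal,
        folded s_def X_def L_def, unfolded of_nat_add of_nat_mult[of 3] of_nat_numeral]
    ultimately show "3 * (\<Sum>x\<in>X. \<Sum>j<B. \<Sum>l\<in>L. indicator (?A x j l) \<omega>) \<le>
        ennreal N + 3 * (\<Sum>x\<in>X. of_nat (messages k P T (?p x) s \<omega>))"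
      by (simp only: of_nat_sum)
  qed
  also have "\<dots> = ennreal N + 3 * (\<Sum>x\<in>X. expected_messages M k P T (?p x) s)"
    unfolding expected_messages_def
    by (subst nn_integral_add, simp, simp, subst nn_integral_cmult, simp, subst nn_integral_sum)
       (auto simp: emeasure_space_1)
  also have "\<dots> \<le> ennreal N + 3 * (\<Sum>x\<in>X. ennreal (1 / 240 * real T))"
    using few by (intro add_left_mono mult_left_mono sum_mono) (auto intro: less_imp_le)
  also have "3 * (\<Sum>x\<in>X. ennreal r) = ennreal (3 * (3 ^ B * r))" if "0 \<le> r" for r
    using that by (subst sum_ennreal) (simp_all add: finX ennreal_mult')
  then have "ennreal N + 3 * (\<Sum>x\<in>X. ennreal (1 / 240 * real T)) =
      ennreal (N + 3 * (3 ^ B * (1 / 240 * real T)))"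
    by (simp add: N_def flip: ennreal_plus)
  finally have "3 / 2 * N \<le> N + 3 * (3 ^ B * (1 / 240 * real T))"
    by (subst (asm) ennreal_le_iff) (auto simp: N_def)
  then have "N \<le> 3 ^ B * (real T / 40)"
    by (simp add: mult.commute)
  \<comment> \<open>Whole blocks cover at least half of the horizon, and at least a tenth of the
    offsets in a block are late.\<close>
  moreover have "3 ^ B * (real T / 20) \<le> N"
  proof -
    have "real T / 20 \<le> real B * (real k / 10)"
      using block_count_ge[of k T] k T by (simp add: B_def mult.commute)
    also have "\<dots> \<le> real B * real (card L)"
      unfolding L_def by (intro mult_left_mono card_late_offsets k) simp
    finally show ?thesis
      unfolding N_def by (rule mult_left_mono) simp
  qed
  moreover have "(3 :: real) ^ B * real T > 0"
    using k T by simp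
  ultimately show False
    by simp
qed

theorem theorem4:
  "(\<exists>c>0. \<forall>(k::nat) (n::nat) (T::nat) (\<beta>::real).
      1 \<le> k \<longrightarrow> 2 \<le> n \<longrightarrow> 0 \<le> \<beta> \<longrightarrow> \<beta> \<le> real k \<longrightarrow> \<beta> \<le> real T \<longrightarrow>
      (\<exists>C. approximate_counter k n T \<beta> C \<and>
        (\<forall>(M :: 'w measure) A. decision_algorithm M n A \<longrightarrow>
          (\<exists>p s. adversary k n T p s \<and>
            expected_regret M A C n T p s \<ge> c * sqrt (\<beta> * real T)))))
   \<and>
   (\<exists>c>0. \<forall>(k::nat) (n::nat) (T::nat) (M :: 'w measure) (P :: ('w, 'm) protocol).
      2 \<le> k \<longrightarrow> 2 \<le> n \<longrightarrow> k \<le> T \<longrightarrow>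
      randomized_protocol M k n T P \<longrightarrow>
      approximates_with_probability M k n T (real k / 10) (1 / 2) P \<longrightarrow>
      (\<exists>p s. adversary k n T p s \<and>
        expected_messages M k P T p s \<ge> ennreal (c * real T)))"
proof (intro conjI)
  show "\<exists>c>0. \<forall>(k::nat) (n::nat) (T::nat) (\<beta>::real).
      1 \<le> k \<longrightarrow> 2 \<le> n \<longrightarrow> 0 \<le> \<beta> \<longrightarrow> \<beta> \<le> real k \<longrightarrow> \<beta> \<le> real T \<longrightarrow>
      (\<exists>C. approximate_counter k n T \<beta> C \<and>
        (\<forall>(M :: 'w measure) A. decision_algorithm M n A \<longrightarrow>
          (\<exists>p s. adversary k n T p s \<and>
            expected_regret M A C n T p s \<ge> c * sqrt (\<beta> * real T))))"
    by (intro exI[of _ "1 / 8"] conjI allI impI regret_lower_bound) auto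
  show "\<exists>c>0. \<forall>(k::nat) (n::nat) (T::nat) (M :: 'w measure) (P :: ('w, 'm) protocol).
      2 \<le> k \<longrightarrow> 2 \<le> n \<longrightarrow> k \<le> T \<longrightarrow>
      randomized_protocol M k n T P \<longrightarrow>
      approximates_with_probability M k n T (real k / 10) (1 / 2) P \<longrightarrow>
      (\<exists>p s. adversary k n T p s \<and>
        expected_messages M k P T p s \<ge> ennreal (c * real T))"
    by (intro exI[of _ "1 / 240"] conjI allI impI communication_lower_bound) auto
qed

end
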